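(* Let $1\le \tilde l\le l\le |E|+1$ and let $q^{\tilde l}\in Q$ be an optimal solution of $\mathcal P(\tilde l)$. If $q^{\tilde l}$ does not contain any of the elements $e_1,\dots,e_{l-1}$, then $q^{\tilde l}$ is an optimal solution of $\mathcal P(l)$.
   Context: Let $E$ be a finite set, $Q\subseteq 2^{E}$ a set of feasible solutions, and let each $e\in E$ have a nominal cost $\hat c_e\in\mathbb R$ and an interval length $\delta_e\ge 0$; let $\Gamma$ be an integer with $0\le\Gamma\le|E|$ (these data form a single-objective combinatorial optimization problem with cardinality-constrained uncertainty). The elements are ordered $E=\{e_1,\dots,e_{|E|}\}$ such that, with $\bar\delta_j:=\delta_{e_j}$ for $j\le |E|$ and $\bar\delta_{|E|+1}:=0$, we have $\bar\delta_1\ge\bar\delta_2\ge\dots\ge\bar\delta_{|E|}\ge\bar\delta_{|E|+1}$. For $l\in\{1,\dots,|E|+1\}$ the subproblem $\mathcal P(l)$ is $$\min_{q\in Q} g^l(q),\qquad g^l(q):=\sum_{e\in q}\hat c_e+\Gamma\cdot\bar\delta_l+\sum_{e_j\in q,\ j\le l}(\delta_{e_j}-\bar\delta_l).$$ *)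

theory Defs
  imports Complex_Main
begin

(* The ordering E = {e_1, ..., e_|E|} is given by an enumeration e of E with indices 1, ..., |E|. *)

definition delta_bar :: "'a set \<Rightarrow> ('a \<Rightarrow> real) \<Rightarrow> (nat \<Rightarrow> 'a) \<Rightarrow> nat \<Rightarrow> real" where
  "delta_bar E \<delta> e j = (if j \<le> card E then \<delta> (e j) else 0)"

(* The index j is bounded by |E| as well as by l because there is no element e_(|E|+1). *)

definition subproblem_cost ::
  "'a set \<Rightarrow> ('a \<Rightarrow> real) \<Rightarrow> ('a \<Rightarrow> real) \<Rightarrow> nat \<Rightarrow> (nat \<Rightarrow> 'a) \<Rightarrow> nat \<Rightarrow> 'a set \<Rightarrow> real" where
  "subproblem_cost E c \<delta> \<Gamma> e l q =
     (\<Sum>x\<in>q. c x) + real \<Gamma> * delta_bar E \<delta> e l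
     + (\<Sum>j | j \<in> {1..card E} \<and> j \<le> l \<and> e j \<in> q. \<delta> (e j) - delta_bar E \<delta> e l)"

definition optimal_solution ::
  "'a set \<Rightarrow> 'a set set \<Rightarrow> ('a \<Rightarrow> real) \<Rightarrow> ('a \<Rightarrow> real) \<Rightarrow> nat \<Rightarrow> (nat \<Rightarrow> 'a) \<Rightarrow> nat \<Rightarrow> 'a set \<Rightarrow> bool" where
  "optimal_solution E Q c \<delta> \<Gamma> e l q \<longleftrightarrow>
     is_arg_min (subproblem_cost E c \<delta> \<Gamma> e l) (\<lambda>q'. q' \<in> Q) q"

end

theory Submission
  imports Defs
begin

text \<open>
  Apart from the nominal cost and the constant \<open>\<Gamma> \<cdot> \<delta>_l\<close>, the cost of a solution in
  the \<open>l\<close>-th subproblem is the total excess of the lengths of its elements among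
  \<open>e 1, \<dots>, e l\<close> over the threshold \<open>\<delta>_l\<close>.
  As \<open>l\<close> grows, the threshold drops and more elements count, so the excess of every solution can
  only grow (\<open>excess_mono\<close>). A solution that avoids the first \<open>l - 1\<close> elements has excess zero at
  \<open>l\<close> and at every earlier index (\<open>excess_eq_0\<close>). Hence passing from the earlier subproblem to
  the \<open>l\<close>-th one leaves the cost of that solution unchanged up to the constant, while no competitor
  becomes cheaper relative to it.
\<close>

definition excess :: "'a set \<Rightarrow> ('a \<Rightarrow> real) \<Rightarrow> (nat \<Rightarrow> 'a) \<Rightarrow> nat \<Rightarrow> 'a set \<Rightarrow> real" where
  "excess E \<delta> e l q =
     (\<Sum>j | j \<in> {1..card E} \<and> j \<le> l \<and> e j \<in> q. \<delta> (e j) - delta_bar E \<delta> e l)"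

lemma subproblem_cost_eq_excess:
  "subproblem_cost E c \<delta> \<Gamma> e l q =
     sum c q + real \<Gamma> * delta_bar E \<delta> e l + excess E \<delta> e l q"
  by (simp add: subproblem_cost_def excess_def)

lemma delta_bar_antimono:
  assumes step: "\<And>j. j \<in> {1..card E} \<Longrightarrow> delta_bar E \<delta> e (j + 1) \<le> delta_bar E \<delta> e j"
    and "i \<le> k" "1 \<le> i" "k \<le> card E + 1"
  shows "delta_bar E \<delta> e k \<le> delta_bar E \<delta> e i"
  using \<open>i \<le> k\<close> \<open>k \<le> card E + 1\<close>
proof (induction k rule: dec_induct)
  case base
  show ?case by simp
next
  case (step n)
  have "delta_bar E \<delta> e (n + 1) \<le> delta_bar E \<delta> e n"
    using assms(1)[of n] step.hyps step.prems \<open>1 \<le> i\<close> by simp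
  with step show ?case by simp
qed

text \<open>
  The summand of index \<open>l\<close> vanishes because \<open>e l\<close> has length exactly equal to the threshold;
  this is why only the elements strictly before \<open>l\<close> have to be avoided.
\<close>

lemma excess_eq_0:
  assumes "\<And>j. 1 \<le> j \<Longrightarrow> j < l \<Longrightarrow> e j \<notin> q"
  shows "excess E \<delta> e l q = 0"
  unfolding excess_def
proof (rule sum.neutral, rule ballI)
  fix j assume j: "j \<in> {j. j \<in> {1..card E} \<and> j \<le> l \<and> e j \<in> q}"
  with assms[of j] have "j = l" by (auto simp: order.order_iff_strict)
  with j show "\<delta> (e j) - delta_bar E \<delta> e l = 0" by (simp add: delta_bar_def)
qed

text \<open>
  Each summand present at \<open>i\<close> grows as the threshold falls, and the summands that are new at \<open>k\<close>
  are nonnegative because the elements up to index \<open>k\<close> are at least as long as the threshold.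
\<close>

lemma excess_mono:
  assumes step: "\<And>j. j \<in> {1..card E} \<Longrightarrow> delta_bar E \<delta> e (j + 1) \<le> delta_bar E \<delta> e j"
    and "i \<le> k" "1 \<le> i" "k \<le> card E + 1"
  shows "excess E \<delta> e i q \<le> excess E \<delta> e k q"
proof -
  define J where "J m = {j. j \<in> {1..card E} \<and> j \<le> m \<and> e j \<in> q}" for m
  have fin: "finite (J k)" by (simp add: J_def)
  have sub: "J i \<subseteq> J k" using \<open>i \<le> k\<close> by (auto simp: J_def)
  have nonneg: "0 \<le> \<delta> (e j) - delta_bar E \<delta> e k" if "j \<in> J k" for j
    using delta_bar_antimono[OF step, of j k] that \<open>k \<le> card E + 1\<close>
    by (simp add: J_def delta_bar_def)
  have "(\<Sum>j\<in>J i. \<delta> (e j) - delta_bar E \<delta> e i) \<le> (\<Sum>j\<in>J i. \<delta> (e j) - delta_bar E \<delta> e k)"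
    using delta_bar_antimono[OF assms] by (intro sum_mono) simp
  also have "\<dots> \<le> (\<Sum>j\<in>J k. \<delta> (e j) - delta_bar E \<delta> e k)"
    using fin sub nonneg by (intro sum_mono2) auto
  finally show ?thesis by (simp add: excess_def J_def)
qed

theorem lemma14:
  fixes E :: "'a set" and Q :: "'a set set"
    and c \<delta> :: "'a \<Rightarrow> real" and \<Gamma> :: nat
    and e :: "nat \<Rightarrow> 'a" and l l' :: nat and q :: "'a set"
  assumes "finite E"
    and "Q \<subseteq> Pow E"
    and "\<And>x. x \<in> E \<Longrightarrow> \<delta> x \<ge> 0"
    and "\<Gamma> \<le> card E"
    and "bij_betw e {1..card E} E"
    and "\<And>j. j \<in> {1..card E} \<Longrightarrow> delta_bar E \<delta> e j \<ge> delta_bar E \<delta> e (j + 1)"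
    and "1 \<le> l'" and "l' \<le> l" and "l \<le> card E + 1"
    and "optimal_solution E Q c \<delta> \<Gamma> e l' q"
    and "\<And>j. 1 \<le> j \<Longrightarrow> j \<le> l - 1 \<Longrightarrow> e j \<notin> q"
  shows "optimal_solution E Q c \<delta> \<Gamma> e l q"
proof -
  have "q \<in> Q"
    and opt: "\<And>p. p \<in> Q \<Longrightarrow> subproblem_cost E c \<delta> \<Gamma> e l' q \<le> subproblem_cost E c \<delta> \<Gamma> e l' p"
    using assms(10) by (auto simp: optimal_solution_def is_arg_min_linorder)
  have zero: "excess E \<delta> e l q = 0" "excess E \<delta> e l' q = 0"
    using assms(8,11) by (auto intro!: excess_eq_0)
  have "subproblem_cost E c \<delta> \<Gamma> e l q \<le> subproblem_cost E c \<delta> \<Gamma> e l p" if "p \<in> Q" for p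
  proof -
    have "sum c q \<le> sum c p + excess E \<delta> e l' p"
      using opt[OF that] zero by (simp add: subproblem_cost_eq_excess)
    also have "\<dots> \<le> sum c p + excess E \<delta> e l p"
      using excess_mono[OF assms(6,8,7,9)] by simp
    finally show ?thesis
      using zero by (simp add: subproblem_cost_eq_excess)
  qed
  with \<open>q \<in> Q\<close> show ?thesis
    by (simp add: optimal_solution_def is_arg_min_linorder)
qed

end
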